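(* Let $\mathcal{H}$ be a complex Hilbert space, let $T,S$ be $EP$ operators on $\mathcal{H}$ and let $A\in\mathcal{B}(\mathcal{H})$. If $AT=SA$ and $AT^*T=S^*SA$, then $AT^*=S^*A$.
   Context: $\mathcal{B}(\mathcal{H})$ is the space of bounded linear operators on $\mathcal{H}$; $\mathcal{R}(T)$ denotes the range of $T$ and $T^*$ its adjoint. An $EP$ operator on $\mathcal{H}$ is a $T\in\mathcal{B}(\mathcal{H})$ with closed range such that $\mathcal{R}(T)=\mathcal{R}(T^* )$. *)

theory Defs
  imports "HOL-Analysis.Analysis"
begin

text \<open>
  The norm, its topology and the real scalar multiplication are inherited from
  \<open>real_normed_vector\<close>; the axioms below tie them to the complex structure, so that library
  notions such as \<open>closed\<close> and \<open>bounded_linear\<close> apply. The inner product is linear in its first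
  argument. The redundancies (for instance, the triangle inequality already follows from
  \<open>norm_eq_sqrt_cinner\<close>) exclude no complex inner product space.
\<close>

class complex_inner = real_normed_vector +
  fixes scaleC :: "complex \<Rightarrow> 'a \<Rightarrow> 'a" (infixr \<open>*\<^sub>C\<close> 75)
    and cinner :: "'a \<Rightarrow> 'a \<Rightarrow> complex"
  assumes scaleC_add_right: "c *\<^sub>C (x + y) = c *\<^sub>C x + c *\<^sub>C y"
    and scaleC_add_left: "(c + d) *\<^sub>C x = c *\<^sub>C x + d *\<^sub>C x"
    and scaleC_scaleC: "c *\<^sub>C d *\<^sub>C x = (c * d) *\<^sub>C x"
    and scaleC_one: "1 *\<^sub>C x = x"
    and scaleR_eq_scaleC: "r *\<^sub>R x = complex_of_real r *\<^sub>C x"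
    and cinner_commute: "cinner x y = cnj (cinner y x)"
    and cinner_add_left: "cinner (x + y) z = cinner x z + cinner y z"
    and cinner_scaleC_left: "cinner (c *\<^sub>C x) y = c * cinner x y"
    and cinner_ge_zero: "0 \<le> Re (cinner x x)"
    and cinner_eq_zero_iff: "cinner x x = 0 \<longleftrightarrow> x = 0"
    and norm_eq_sqrt_cinner: "norm x = sqrt (Re (cinner x x))"

class chilbert_space = complex_inner + complete_space

subclass (in chilbert_space) banach ..

instantiation complex :: chilbert_space
begin

definition scaleC_complex :: "complex \<Rightarrow> complex \<Rightarrow> complex" where
  "scaleC_complex c x = c * x"

definition cinner_complex :: "complex \<Rightarrow> complex \<Rightarrow> complex" where
  "cinner_complex x y = x * cnj y"

instance
proof
  fix x :: complex
  show "norm x = sqrt (Re (cinner x x))"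
    by (simp add: cinner_complex_def cmod_def power2_eq_square)
qed (auto simp: scaleC_complex_def cinner_complex_def algebra_simps scaleR_conv_of_real)

end

definition bounded_clinear :: "('a::complex_inner \<Rightarrow> 'b::complex_inner) \<Rightarrow> bool" where
  "bounded_clinear T \<longleftrightarrow> bounded_linear T \<and> (\<forall>c x. T (c *\<^sub>C x) = c *\<^sub>C T x)"

text \<open>
  The complex counterpart of the library's \<open>adjoint\<close>, which is restricted to real inner products.
  For a bounded operator between Hilbert spaces, such a \<open>G\<close> exists by the Riesz representation
  theorem and is unique; the value is arbitrary when no such \<open>G\<close> exists.
\<close>

definition cadjoint :: "('a::complex_inner \<Rightarrow> 'b::complex_inner) \<Rightarrow> 'b \<Rightarrow> 'a" where
  "cadjoint T = (SOME G. \<forall>x y. cinner (T x) y = cinner x (G y))"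

definition EP_operator :: "('a::chilbert_space \<Rightarrow> 'a) \<Rightarrow> bool" where
  "EP_operator T \<longleftrightarrow> bounded_clinear T \<and> closed (range T) \<and> range T = range (cadjoint T)"

end

theory Submission
  imports Defs
begin

text \<open>
  Put \<open>D = A T\<^sup>* - S\<^sup>* A\<close>. The two hypotheses combine to
  \<open>A T\<^sup>* T = S\<^sup>* S A = S\<^sup>* A T\<close>, so \<open>D\<close> vanishes on the range of \<open>T\<close>. Since that range is closed,
  the projection theorem (\<open>orthogonal_decomposition\<close>) leaves only the vectors orthogonal to it,
  that is, the kernel of \<open>T\<^sup>*\<close>. For an EP operator \<open>T\<close> the operators \<open>T\<close> and \<open>T\<^sup>*\<close> have the same
  kernel (\<open>EP_operator_kernel\<close>), because each kernel is the orthogonal complement of the range of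
  the other operator. So if \<open>T\<^sup>* n = 0\<close>, then \<open>T n = 0\<close>, hence \<open>S (A n) = A (T n) = 0\<close>, and
  applying the kernel equality to \<open>S\<close> gives \<open>S\<^sup>* (A n) = 0\<close>. Thus \<open>D\<close> vanishes there as well.

  Being a choice, \<open>cadjoint\<close> satisfies its defining identity only once an adjoint is known to
  exist. Existence comes from the Riesz representation theorem (\<open>riesz_representation\<close>), which is
  derived here from the projection theorem.
\<close>

section \<open>Complex inner products\<close>

lemma cinner_zero_left [simp]: "cinner 0 (z::'a::complex_inner) = 0"
  using cinner_add_left[of 0 0 z] by simp

lemma cinner_zero_right [simp]: "cinner (z::'a::complex_inner) 0 = 0"
  by (subst cinner_commute) simp

lemma cinner_add_right: "cinner z (x + y) = cinner z x + cinner z (y::'a::complex_inner)"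
  by (metis cinner_commute cinner_add_left complex_cnj_add)

lemma cinner_scaleC_right: "cinner x (c *\<^sub>C y) = cnj c * cinner x (y::'a::complex_inner)"
  by (metis cinner_commute cinner_scaleC_left complex_cnj_mult)

lemma cinner_diff_left: "cinner (x - y) z = cinner x z - cinner y (z::'a::complex_inner)"
  using cinner_add_left[of "x - y" y z] by (simp add: algebra_simps)

lemma cinner_diff_right: "cinner z (x - y) = cinner z x - cinner z (y::'a::complex_inner)"
  using cinner_add_right[of z "x - y" y] by (simp add: algebra_simps)

lemma cinner_self: "cinner x x = complex_of_real ((norm (x::'a::complex_inner))\<^sup>2)"
proof -
  have "Im (cinner x x) = 0"
    using arg_cong[OF cinner_commute[of x x], of Im] by simp
  then show ?thesis
    by (simp add: complex_eq_iff norm_eq_sqrt_cinner cinner_ge_zero)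
qed

lemma norm_add_squared:
  "(norm (x + y))\<^sup>2 = (norm x)\<^sup>2 + (norm y)\<^sup>2 + 2 * Re (cinner x (y::'a::complex_inner))"
proof -
  have "Re (cinner y x) = Re (cinner x y)"
    by (subst cinner_commute) simp
  moreover have "Re (cinner (x + y) (x + y))
      = Re (cinner x x) + Re (cinner y y) + (Re (cinner x y) + Re (cinner y x))"
    by (simp add: cinner_add_left cinner_add_right)
  ultimately show ?thesis
    by (simp add: cinner_self del: of_real_power)
qed

lemma norm_diff_squared:
  "(norm (x - y))\<^sup>2 = (norm x)\<^sup>2 + (norm y)\<^sup>2 - 2 * Re (cinner x (y::'a::complex_inner))"
  using norm_add_squared[of "x - y" y] by (simp add: cinner_diff_left cinner_self del: of_real_power)

lemma norm_scaleC: "norm (c *\<^sub>C (x::'a::complex_inner)) = cmod c * norm x"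
proof -
  have "complex_of_real ((norm (c *\<^sub>C x))\<^sup>2) = complex_of_real ((cmod c * norm x)\<^sup>2)"
    unfolding cinner_self[symmetric] cinner_scaleC_left cinner_scaleC_right
    by (simp add: cinner_self power_mult_distrib complex_norm_square del: of_real_power
        flip: mult.assoc)
  then show ?thesis
    unfolding of_real_eq_iff by (simp add: power2_eq_iff_nonneg)
qed

text \<open>
  The real part is controlled by the triangle inequality for the norm, after squaring; multiplying
  \<open>x\<close> by the conjugate of \<open>cinner x y\<close> turns this into a bound on the modulus.
\<close>

lemma cinner_cauchy_schwarz: "cmod (cinner x y) \<le> norm x * norm (y::'a::complex_inner)"
proof (cases "cinner x y = 0")
  case False
  have Re_le: "Re (cinner u v) \<le> norm u * norm v" for u v :: 'a
    using power_mono[OF norm_triangle_ineq[of u v] norm_ge_zero, of 2]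
    by (simp add: norm_add_squared power2_sum)
  let ?c = "cinner x y"
  have "(cmod ?c)\<^sup>2 = Re (cinner (cnj ?c *\<^sub>C x) y)"
    unfolding cmod_power2 by (simp add: cinner_scaleC_left power2_eq_square)
  also have "\<dots> \<le> cmod ?c * (norm x * norm y)"
    using Re_le[of "cnj ?c *\<^sub>C x" y] by (simp add: norm_scaleC mult.assoc)
  finally show ?thesis
    using False by (simp add: power2_eq_square)
qed simp

lemma bounded_linear_cinner_left: "bounded_linear (\<lambda>x. cinner x (y::'a::complex_inner))"
  by (rule bounded_linear_intro[where K = "norm y"])
     (simp_all add: cinner_add_left scaleR_eq_scaleC cinner_scaleC_left cinner_cauchy_schwarz
        scaleR_conv_of_real[symmetric])

lemma cinner_ext_right:
  assumes "\<And>x. cinner x y = cinner x (z::'a::complex_inner)"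
  shows "y = z"
  using assms[of "y - z"] cinner_eq_zero_iff[of "y - z"] by (simp add: cinner_diff_right)

section \<open>Orthogonal projection onto a closed subspace\<close>

text \<open>
  The points of \<open>M\<close> whose distance from \<open>x\<close> exceeds the infimum by at most \<open>1 / (n + 1)\<close> form a
  decreasing sequence of closed sets. The parallelogram law at \<open>x\<close> bounds their diameters, since
  the midpoint of two such points lies in \<open>M\<close> and so cannot be closer than the infimum. By
  completeness they have a common point.
\<close>

lemma closed_convex_nearest_point:
  fixes x :: "'a::chilbert_space"
  assumes "closed M" "convex M" "M \<noteq> {}"
  obtains m where "m \<in> M" "\<And>w. w \<in> M \<Longrightarrow> norm (x - m) \<le> norm (x - w)"
proof -
  define d where "d = infdist x M"
  define C where "C n = M \<inter> cball x (d + 1 / (real n + 1))" for n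
  have d_le: "d \<le> norm (x - w)" if "w \<in> M" for w
    using infdist_le[OF that, of x] by (simp add: d_def dist_norm)
  have d0: "0 \<le> d"
    by (simp add: d_def infdist_nonneg)
  have "\<exists>a. \<forall>n. a \<in> C n"
  proof (rule decreasing_closed_nest)
    show "closed (C n)" for n
      using assms(1) by (simp add: C_def closed_Int)
    show "C n \<noteq> {}" for n
    proof -
      have "Inf (dist x ` M) < d + 1 / (real n + 1)"
        using assms(3) by (simp add: d_def infdist_def)
      then obtain w where "w \<in> M" "dist x w < d + 1 / (real n + 1)"
        using assms(3) cInf_lessD[of "dist x ` M"] by blast
      then show ?thesis
        by (auto simp: C_def)
    qed
    show "C n \<subseteq> C m" if "m \<le> n" for m n
    proof -
      have "1 / (real n + 1) \<le> 1 / (real m + 1)"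
        using that by (simp add: frac_le)
      then show ?thesis
        by (auto simp: C_def)
    qed
    fix e :: real
    assume e: "0 < e"
    have "(\<lambda>n. 4 * (d + 1 / (real n + 1))\<^sup>2 - 4 * d\<^sup>2) \<longlonglongrightarrow> 4 * (d + 0)\<^sup>2 - 4 * d\<^sup>2"
      by (intro tendsto_intros LIMSEQ_Suc[OF lim_1_over_n, unfolded of_nat_Suc add.commute[of 1]])
    then have "(\<lambda>n. 4 * (d + 1 / (real n + 1))\<^sup>2 - 4 * d\<^sup>2) \<longlonglongrightarrow> 0"
      by simp
    then have "eventually (\<lambda>n. 4 * (d + 1 / (real n + 1))\<^sup>2 - 4 * d\<^sup>2 < e\<^sup>2) sequentially"
      using e by (intro order_tendstoD) auto
    then obtain n where n: "4 * (d + 1 / (real n + 1))\<^sup>2 - 4 * d\<^sup>2 < e\<^sup>2"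
      by (auto simp: eventually_sequentially)
    have "dist u v < e" if u: "u \<in> C n" and v: "v \<in> C n" for u v
    proof -
      let ?r = "d + 1 / (real n + 1)"
      have "(1/2) *\<^sub>R u + (1/2) *\<^sub>R v \<in> M"
        using u v assms(2) by (intro convexD) (auto simp: C_def)
      moreover have "2 *\<^sub>R (x - ((1/2) *\<^sub>R u + (1/2) *\<^sub>R v)) = (x - u) + (x - v)"
        by (simp add: algebra_simps scaleR_2)
      then have "norm ((x - u) + (x - v)) = 2 * norm (x - ((1/2) *\<^sub>R u + (1/2) *\<^sub>R v))"
        by (metis abs_numeral norm_scaleR)
      ultimately have "2 * d \<le> norm ((x - u) + (x - v))"
        using d_le by fastforce
      then have mid: "(2 * d)\<^sup>2 \<le> (norm ((x - u) + (x - v)))\<^sup>2"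
        using d0 by (intro power_mono) auto
      have "(norm (x - u))\<^sup>2 \<le> ?r\<^sup>2" "(norm (x - v))\<^sup>2 \<le> ?r\<^sup>2"
        using u v by (auto simp: C_def dist_norm intro!: power_mono)
      moreover have "(norm ((x - u) - (x - v)))\<^sup>2
          = 2 * (norm (x - u))\<^sup>2 + 2 * (norm (x - v))\<^sup>2 - (norm ((x - u) + (x - v)))\<^sup>2"
        unfolding norm_add_squared norm_diff_squared[of "x - u" "x - v"] by simp
      ultimately have "(norm ((x - u) - (x - v)))\<^sup>2 < e\<^sup>2"
        using mid n by (simp add: power_mult_distrib)
      then have "norm ((x - u) - (x - v)) < e"
        using e by (simp add: power2_less_imp_less)
      then show ?thesis
        by (simp add: dist_norm norm_minus_commute)
    qed
    then show "\<exists>n. \<forall>u\<in>C n. \<forall>v\<in>C n. dist u v < e"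
      by blast
  qed blast
  then obtain m where m: "\<And>n. m \<in> C n"
    by blast
  have "(\<lambda>n. d + 1 / (real n + 1)) \<longlonglongrightarrow> d + 0"
    by (intro tendsto_intros LIMSEQ_Suc[OF lim_1_over_n, unfolded of_nat_Suc add.commute[of 1]])
  then have "norm (x - m) \<le> d + 0"
    using m by (intro LIMSEQ_le_const) (auto simp: C_def dist_norm)
  then show thesis
    using that[of m] m[of 0] d_le by (fastforce simp: C_def)
qed

lemma orthogonal_decomposition:
  fixes x :: "'a::chilbert_space"
  assumes "closed M" "subspace M" and scaleC: "\<And>c w. w \<in> M \<Longrightarrow> c *\<^sub>C w \<in> M"
  obtains m n where "x = m + n" "m \<in> M" "\<And>w. w \<in> M \<Longrightarrow> cinner n w = 0"
proof -
  obtain m where m: "m \<in> M" and nearest: "\<And>w. w \<in> M \<Longrightarrow> norm (x - m) \<le> norm (x - w)"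
    using closed_convex_nearest_point[of M x] assms subspace_imp_convex subspace_0 by blast
  have "cinner (x - m) w = 0" if w: "w \<in> M" for w
  proof (rule ccontr)
    let ?a = "cinner (x - m) w"
    assume a: "?a \<noteq> 0"
    \<comment> \<open>Moving from \<open>m\<close> in the direction \<open>?a *\<^sub>C w\<close> by a step \<open>t\<close> changes the squared distance by
      \<open>t * (cmod ?a)\<^sup>2 * (t * (norm w)\<^sup>2 - 2)\<close>; any small \<open>t > 0\<close> makes this negative, and this \<open>t\<close>
      satisfies \<open>t * (norm w)\<^sup>2 < 1\<close> even for \<open>w = 0\<close>.\<close>
    define t where "t = 1 / ((norm w)\<^sup>2 + 1)"
    define c where "c = complex_of_real t * ?a"
    have t: "0 < t" "t * (norm w)\<^sup>2 < 2"
      by (auto simp: t_def field_simps add_pos_nonneg add_nonneg_pos)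
    have "norm (x - m) \<le> norm (x - (m + c *\<^sub>C w))"
      using nearest subspace_add[OF assms(2) m scaleC[OF w]] by blast
    then have "(norm (x - m))\<^sup>2 \<le> (norm ((x - m) - c *\<^sub>C w))\<^sup>2"
      by (simp add: algebra_simps power_mono)
    also have "\<dots> = (norm (x - m))\<^sup>2 + (cmod c * norm w)\<^sup>2 - 2 * Re (cnj c * ?a)"
      by (simp add: norm_diff_squared cinner_scaleC_right norm_scaleC)
    finally have "2 * Re (cnj c * ?a) \<le> (cmod c * norm w)\<^sup>2"
      by simp
    moreover have "Re (cnj c * ?a) = t * (cmod ?a)\<^sup>2"
      unfolding cmod_power2 by (simp add: c_def power2_eq_square algebra_simps)
    moreover have "cmod c = t * cmod ?a"
      using t by (simp add: c_def norm_mult)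
    ultimately have "(t * (cmod ?a)\<^sup>2) * 2 \<le> (t * (cmod ?a)\<^sup>2) * (t * (norm w)\<^sup>2)"
      by (simp add: power2_eq_square algebra_simps)
    then show False
      using t a by (simp add: mult_le_cancel_left)
  qed
  with m show thesis
    using that[of m "x - m"] by simp
qed

section \<open>Existence of adjoints\<close>

text \<open>
  A nonzero \<open>f\<close> has a nonzero vector \<open>n\<close> orthogonal to its kernel. As \<open>f n *\<^sub>C x - f x *\<^sub>C n\<close> lies in
  the kernel, pairing it with \<open>n\<close> expresses \<open>f x\<close> as a multiple of \<open>cinner x n\<close>.
\<close>

lemma riesz_representation:
  fixes f :: "'a::chilbert_space \<Rightarrow> complex"
  assumes "bounded_clinear f"
  obtains y where "\<And>x. f x = cinner x y"
proof (cases "\<forall>x. f x = 0")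
  case True
  then show thesis
    using that[of 0] by simp
next
  case False
  then obtain x0 where x0: "f x0 \<noteq> 0"
    by blast
  have bl: "bounded_linear f" and sc: "f (c *\<^sub>C x) = c * f x" for c x
    using assms by (auto simp: bounded_clinear_def scaleC_complex_def)
  interpret f: bounded_linear f
    by (rule bl)
  define K where "K = {x. f x = 0}"
  have "closed K"
    unfolding K_def by (intro closed_Collect_eq continuous_intros f.continuous_on)
  moreover have "subspace K"
    by (simp add: subspace_def K_def f.zero f.add f.scaleR)
  moreover have "c *\<^sub>C w \<in> K" if "w \<in> K" for c w
    using that by (simp add: K_def sc)
  ultimately obtain m n where mn: "x0 = m + n" "m \<in> K" and orth: "\<And>w. w \<in> K \<Longrightarrow> cinner n w = 0"
    using orthogonal_decomposition by blast
  have fn: "f n \<noteq> 0"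
    using x0 mn by (simp add: K_def f.add)
  then have nn: "cinner n n \<noteq> 0"
    using f.zero cinner_eq_zero_iff by metis
  have "f x = cinner x (cnj (f n / cinner n n) *\<^sub>C n)" for x
  proof -
    have "f n *\<^sub>C x - f x *\<^sub>C n \<in> K"
      by (simp add: K_def f.diff sc)
    then have "cinner (f n *\<^sub>C x - f x *\<^sub>C n) n = 0"
      using orth cinner_commute by (metis complex_cnj_zero)
    then show ?thesis
      using nn by (simp add: cinner_diff_left cinner_scaleC_left cinner_scaleC_right field_simps)
  qed
  then show thesis
    using that by blast
qed

lemma cinner_cadjoint:
  fixes T :: "'a::chilbert_space \<Rightarrow> 'b::complex_inner"
  assumes "bounded_clinear T"
  shows "cinner (T x) y = cinner x (cadjoint T y)"
proof -
  have "\<exists>z. \<forall>x. cinner (T x) y = cinner x z" for y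
  proof -
    have "bounded_clinear (\<lambda>x. cinner (T x) y)"
      using assms bounded_linear_compose[OF bounded_linear_cinner_left[of y], of T]
      by (simp add: bounded_clinear_def scaleC_complex_def cinner_scaleC_left)
    then show ?thesis
      using riesz_representation by metis
  qed
  then have "\<exists>G. \<forall>x y. cinner (T x) y = cinner x (G y)"
    by metis
  then have "\<forall>x y. cinner (T x) y = cinner x (cadjoint T y)"
    unfolding cadjoint_def by (rule someI_ex)
  then show ?thesis
    by blast
qed

lemma cadjoint_add:
  fixes T :: "'a::chilbert_space \<Rightarrow> 'b::complex_inner"
  assumes "bounded_clinear T"
  shows "cadjoint T (x + y) = cadjoint T x + cadjoint T y"
  by (rule cinner_ext_right) (simp add: cinner_add_right flip: cinner_cadjoint[OF assms])

section \<open>EP operators\<close>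

lemma kernel_iff_orthogonal_range_cadjoint:
  fixes T :: "'a::chilbert_space \<Rightarrow> 'b::complex_inner"
  assumes "bounded_clinear T"
  shows "T x = 0 \<longleftrightarrow> (\<forall>w\<in>range (cadjoint T). cinner x w = 0)"
  by (auto simp flip: cinner_cadjoint[OF assms]) (metis cinner_eq_zero_iff)

lemma cadjoint_kernel_iff_orthogonal_range:
  fixes T :: "'a::chilbert_space \<Rightarrow> 'b::complex_inner"
  assumes "bounded_clinear T"
  shows "cadjoint T y = 0 \<longleftrightarrow> (\<forall>w\<in>range T. cinner y w = 0)"
proof -
  have "cinner y (T x) = cnj (cinner x (cadjoint T y))" for x
    using cinner_commute cinner_cadjoint[OF assms] by metis
  then show ?thesis
    by (auto simp: complex_cnj_zero_iff) (metis cinner_eq_zero_iff)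
qed

lemma EP_operator_kernel:
  assumes "EP_operator T"
  shows "T x = 0 \<longleftrightarrow> cadjoint T x = 0"
proof -
  have "bounded_clinear T" "range T = range (cadjoint T)"
    using assms by (auto simp: EP_operator_def)
  then show ?thesis
    by (metis kernel_iff_orthogonal_range_cadjoint cadjoint_kernel_iff_orthogonal_range)
qed

lemma EP_operator_decomposition:
  assumes "EP_operator T"
  obtains u n where "x = T u + n" "cadjoint T n = 0"
proof -
  have T: "bounded_clinear T" and closed: "closed (range T)"
    using assms by (auto simp: EP_operator_def)
  interpret T: bounded_linear T
    using T by (simp add: bounded_clinear_def)
  have sub: "subspace (range T)"
    using linear_subspace_image[OF T.linear subspace_UNIV] .
  have "c *\<^sub>C w \<in> range T" if "w \<in> range T" for c w
    using that T unfolding bounded_clinear_def by (metis rangeE rangeI)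
  then obtain m n where "x = m + n" "m \<in> range T" "\<And>w. w \<in> range T \<Longrightarrow> cinner n w = 0"
    using orthogonal_decomposition[OF closed sub] by blast
  then show thesis
    using that cadjoint_kernel_iff_orthogonal_range[OF T] by blast
qed

theorem theorem3p11:
  fixes T S A :: "'a::chilbert_space \<Rightarrow> 'a"
  assumes "EP_operator T"
    and "EP_operator S"
    and "bounded_clinear A"
    and "A \<circ> T = S \<circ> A"
    and "A \<circ> cadjoint T \<circ> T = cadjoint S \<circ> S \<circ> A"
  shows "A \<circ> cadjoint T = cadjoint S \<circ> A"
proof
  fix x
  have T: "bounded_clinear T" and S: "bounded_clinear S"
    using assms(1,2) by (auto simp: EP_operator_def)
  interpret A: bounded_linear A
    using assms(3) by (simp add: bounded_clinear_def)
  have AT: "A (T u) = S (A u)" for u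
    using fun_cong[OF assms(4)] by simp
  have ATT: "A (cadjoint T (T u)) = cadjoint S (S (A u))" for u
    using fun_cong[OF assms(5)] by simp
  obtain u n where x: "x = T u + n" and n: "cadjoint T n = 0"
    using EP_operator_decomposition[OF assms(1)] .
  have "T n = 0"
    using EP_operator_kernel[OF assms(1)] n by simp
  then have "S (A n) = 0"
    using AT[of n] by (simp add: A.zero)
  then have "cadjoint S (A n) = 0"
    using EP_operator_kernel[OF assms(2)] by simp
  then show "(A \<circ> cadjoint T) x = (cadjoint S \<circ> A) x"
    by (simp add: x n AT ATT A.add cadjoint_add[OF T] cadjoint_add[OF S])
qed

end
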